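(* Let $X$ be a compact metric space, $f:X\to X$ a continuous map, $\varphi:X\to\mathbb{R}$ a continuous function, and $\mu\in\mathcal{M}(X,f)$ an $f$-invariant Borel probability measure. Then $$P_\mu(f,\varphi)=\operatorname{ess\,sup}\{P_\mu(f,\varphi,x):x\in X\},$$ where the essential supremum is taken with respect to $\mu$.
   Context: Let $d$ be the metric on $X$; $\mathcal{M}(X,f)$ is the set of $f$-invariant Borel probability measures on $X$. Put $S_n\varphi(x)=\sum_{i=0}^{n-1}\varphi(f^ix)$, $d_n(x,y)=\max\{d(f^ix,f^iy):0\le i<n\}$ and $B_n(x,\epsilon)=\{y\in X:d_n(x,y)<\epsilon\}$. Point-wise measure theoretic pressure at $x\in X$: $$P_\mu(f,\varphi,x)=\lim_{\epsilon\to0}\liminf_{n\to\infty}\frac1n\big[-\log\mu(B_n(x,\epsilon))+S_n\varphi(x)\big].$$ Measure theoretic pressure: for $Z\subset X$, $\alpha\in\mathbb{R}$, $N\in\mathbb{N}$, $\epsilon>0$ let $$M(Z,\varphi,\alpha,N,\epsilon)=\inf\Big\{\sum_i\exp\big(-\alpha n_i+S_{n_i}\varphi(x_i)\big):\bigcup_iB_{n_i}(x_i,\epsilon)\supset Z,\ x_i\in X,\ n_i\ge N\text{ for all }i\Big\},$$ the infimum being over finite or countable families $(x_i,n_i)_i$. Let $m(Z,\varphi,\alpha,\epsilon)=\lim_{N\to\infty}M(Z,\varphi,\alpha,N,\epsilon)$ and $P_Z(f,\varphi,\epsilon)=\inf\{\alpha:m(Z,\varphi,\alpha,\epsilon)=0\}=\sup\{\alpha:m(Z,\varphi,\alpha,\epsilon)=+\infty\}$.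 Let $P_\mu(f,\varphi,\epsilon)=\inf\{P_Z(f,\varphi,\epsilon):\mu(Z)=1\}$ and $P_\mu(f,\varphi)=\lim_{\epsilon\to0}P_\mu(f,\varphi,\epsilon)$. *)

theory Defs
  imports "HOL-Probability.Probability" "HOL-Probability.Essential_Supremum"
begin

definition invariant_measures :: "('a::topological_space \<Rightarrow> 'a) \<Rightarrow> 'a measure set" where
  "invariant_measures f =
     {\<mu>. prob_space \<mu> \<and> sets \<mu> = sets borel \<and>
          (\<forall>A\<in>sets borel. emeasure \<mu> (f -` A) = emeasure \<mu> A)}"

definition birkhoff_sum :: "('a \<Rightarrow> 'a) \<Rightarrow> ('a \<Rightarrow> real) \<Rightarrow> nat \<Rightarrow> 'a \<Rightarrow> real" where
  "birkhoff_sum f \<phi> n x = (\<Sum>i<n. \<phi> ((f ^^ i) x))"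

text \<open>For \<open>n = 0\<close> this is the unspecified value \<open>Max {}\<close>. It occurs only in single terms of
  the limits \<open>n \<rightarrow> \<infinity>\<close> and \<open>N \<rightarrow> \<infinity>\<close> below and does not affect their values.\<close>

definition bowen_dist :: "('a::metric_space \<Rightarrow> 'a) \<Rightarrow> nat \<Rightarrow> 'a \<Rightarrow> 'a \<Rightarrow> real" where
  "bowen_dist f n x y = (MAX i\<in>{..<n}. dist ((f ^^ i) x) ((f ^^ i) y))"

definition bowen_ball :: "('a::metric_space \<Rightarrow> 'a) \<Rightarrow> nat \<Rightarrow> 'a \<Rightarrow> real \<Rightarrow> 'a set" where
  "bowen_ball f n x \<epsilon> = {y. bowen_dist f n x y < \<epsilon>}"

text \<open>\<open>- log p\<close> with the convention \<open>- log 0 = \<infinity>\<close> (on the reals, \<open>ln 0 = 0\<close>).\<close>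

definition neg_log :: "real \<Rightarrow> ereal" where
  "neg_log p = (if p = 0 then \<infinity> else ereal (- ln p))"

text \<open>All pressures are extended-real-valued. The limits \<open>\<epsilon> \<rightarrow> 0\<close> (and \<open>N \<rightarrow> \<infinity>\<close> below) are limits of
  monotone functions, so they exist in the extended reals.\<close>

definition pointwise_pressure ::
  "'a::metric_space measure \<Rightarrow> ('a \<Rightarrow> 'a) \<Rightarrow> ('a \<Rightarrow> real) \<Rightarrow> 'a \<Rightarrow> ereal" where
  "pointwise_pressure \<mu> f \<phi> x =
     Lim (at_right 0) (\<lambda>\<epsilon>::real. liminf (\<lambda>n.
       ereal (1 / real n) *
         (neg_log (measure \<mu> (bowen_ball f n x \<epsilon>)) + ereal (birkhoff_sum f \<phi> n x))))"

text \<open>Finite and countable families \<open>(x\<^sub>i, n\<^sub>i)\<close> are indexed by arbitrary sets \<open>I\<close> of natural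
  numbers; a divergent sum has the value \<open>\<infinity>\<close>.\<close>

definition cover_sum ::
  "('a::metric_space \<Rightarrow> 'a) \<Rightarrow> ('a \<Rightarrow> real) \<Rightarrow> 'a set \<Rightarrow> real \<Rightarrow> nat \<Rightarrow> real \<Rightarrow> ennreal" where
  "cover_sum f \<phi> Z \<alpha> N \<epsilon> =
     Inf {(\<Sum>\<^sub>\<infinity>i\<in>I. ennreal (exp (- \<alpha> * real (n i) + birkhoff_sum f \<phi> (n i) (x i)))) |
            (I :: nat set) (x :: nat \<Rightarrow> 'a) (n :: nat \<Rightarrow> nat).
            Z \<subseteq> (\<Union>i\<in>I. bowen_ball f (n i) (x i) \<epsilon>) \<and> (\<forall>i\<in>I. N \<le> n i)}"

definition cover_limit ::
  "('a::metric_space \<Rightarrow> 'a) \<Rightarrow> ('a \<Rightarrow> real) \<Rightarrow> 'a set \<Rightarrow> real \<Rightarrow> real \<Rightarrow> ennreal" where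
  "cover_limit f \<phi> Z \<alpha> \<epsilon> = lim (\<lambda>N. cover_sum f \<phi> Z \<alpha> N \<epsilon>)"

definition pressure_on_scale ::
  "('a::metric_space \<Rightarrow> 'a) \<Rightarrow> ('a \<Rightarrow> real) \<Rightarrow> 'a set \<Rightarrow> real \<Rightarrow> ereal" where
  "pressure_on_scale f \<phi> Z \<epsilon> = Inf {ereal \<alpha> | \<alpha>. cover_limit f \<phi> Z \<alpha> \<epsilon> = 0}"

definition measure_pressure_scale ::
  "'a::metric_space measure \<Rightarrow> ('a \<Rightarrow> 'a) \<Rightarrow> ('a \<Rightarrow> real) \<Rightarrow> real \<Rightarrow> ereal" where
  "measure_pressure_scale \<mu> f \<phi> \<epsilon> =
     Inf {pressure_on_scale f \<phi> Z \<epsilon> | Z. Z \<in> sets \<mu> \<and> emeasure \<mu> Z = 1}"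

definition measure_pressure ::
  "'a::metric_space measure \<Rightarrow> ('a \<Rightarrow> 'a) \<Rightarrow> ('a \<Rightarrow> real) \<Rightarrow> ereal" where
  "measure_pressure \<mu> f \<phi> = Lim (at_right 0) (\<lambda>\<epsilon>::real. measure_pressure_scale \<mu> f \<phi> \<epsilon>)"

end

theory Submission
  imports Defs
begin

text \<open>If the pointwise pressure \<open>P\<close> at \<open>x\<close> is less than \<open>s\<close>, then there are infinitely many \<open>n\<close> with
  \<open>\<mu> (B\<^sub>n(x, \<epsilon>)) \<ge> exp (- s n + S\<^sub>n \<phi> x)\<close>. For each \<open>n\<close> a maximal separated set of such centres
  carries disjoint balls, so the corresponding exponentials sum to at most \<open>1\<close>, and the balls of
  twice the radius cover; an extra factor \<open>exp (- \<delta> n)\<close> makes the sum over \<open>n \<ge> N\<close> tend to \<open>0\<close>.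
  Conversely, if \<open>P > s\<close> on a set of positive measure, then on a smaller set \<open>A\<close> of positive
  measure the opposite inequality holds for all large \<open>n\<close> at one fixed scale (mass distribution
  principle), and every cover has sum at least \<open>\<mu> A\<close>; the uniform continuity of \<open>\<phi>\<close> pays for
  moving the centre of a ball into \<open>A\<close>.\<close>

section \<open>One-sided limits and unordered sums of extended reals\<close>

text \<open>By monotonicity the scales \<open>1 / (k + 1)\<close> already determine the limit. A
  countable supremum is what later makes the pointwise pressure measurable.\<close>

lemma tendsto_at_right_0_antimono_SUP:
  fixes q :: "real \<Rightarrow> 'b::{complete_linorder, linorder_topology}"
  assumes anti: "\<And>a b. \<lbrakk>0 < a; a \<le> b\<rbrakk> \<Longrightarrow> q b \<le> q a"
  shows "(q \<longlongrightarrow> (SUP k. q (1 / real (Suc k)))) (at_right 0)"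
proof (rule order_tendstoI)
  fix a assume "a < (SUP k. q (1 / real (Suc k)))"
  then obtain k where k: "a < q (1 / real (Suc k))"
    by (auto simp: less_SUP_iff)
  have "\<forall>\<^sub>F e in at_right 0. 0 < e \<and> e < 1 / real (Suc k)"
    by (auto simp: eventually_at_right_field intro!: exI[of _ "1 / real (Suc k)"])
  then show "\<forall>\<^sub>F e in at_right 0. a < q e"
    by eventually_elim (use k anti in \<open>meson less_imp_le less_le_trans\<close>)
next
  fix a assume a: "(SUP k. q (1 / real (Suc k))) < a"
  have "q e < a" if e: "0 < e" for e
  proof -
    obtain k where "1 / real (Suc k) < e"
      using reals_Archimedean[OF e] by (auto simp: inverse_eq_divide)
    then have "q e \<le> q (1 / real (Suc k))"
      by (intro anti) auto
    also have "\<dots> \<le> (SUP k. q (1 / real (Suc k)))"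
      by (rule SUP_upper) simp
    finally show ?thesis using a by simp
  qed
  then show "\<forall>\<^sub>F e in at_right 0. q e < a"
    by (auto simp: eventually_at_right_field intro!: exI[of _ 1])
qed

text \<open>The two bounds give existence and value of the limit at once. Real test values
  \<open>s\<close> suffice, even for infinite \<open>l\<close>, because the reals are dense in the
  extended reals.\<close>

lemma tendsto_at_right_0_ereal_approx:
  fixes q :: "real \<Rightarrow> ereal"
  assumes upper: "\<And>e. 0 < e \<Longrightarrow> q e \<le> l"
    and lower: "\<And>s. ereal s < l \<Longrightarrow> \<forall>\<^sub>F e in at_right 0. ereal s \<le> q e"
  shows "(q \<longlongrightarrow> l) (at_right 0)"
proof (rule order_tendstoI)
  fix a assume "a < l"
  then obtain b where b: "a < b" "b < l" using dense by blast
  then obtain s where s: "b \<le> ereal s" "ereal s < l"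
    by (metis ereal_dense2 less_imp_le)
  show "\<forall>\<^sub>F e in at_right 0. a < q e"
    using lower[OF s(2)] by eventually_elim (use b s in \<open>auto elim!: less_le_trans intro: order_trans\<close>)
next
  fix a assume "l < a"
  then show "\<forall>\<^sub>F e in at_right 0. q e < a"
    by (auto simp: eventually_at_right_field intro!: exI[of _ 1] le_less_trans[OF upper])
qed

lemma infsum_ennreal_le:
  fixes g :: "'b \<Rightarrow> ennreal"
  assumes "\<And>F. \<lbrakk>finite F; F \<subseteq> A\<rbrakk> \<Longrightarrow> sum g F \<le> c"
  shows "infsum g A \<le> c"
  using assms by (subst nonneg_infsum_complete) (auto intro!: SUP_least)

text \<open>Links countable subadditivity, which is stated for a series over all naturals, with
  cover sums, which run over an arbitrary index set \<open>I\<close>.\<close>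

lemma suminf_le_infsum_ennreal:
  fixes g :: "nat \<Rightarrow> ennreal"
  shows "(\<Sum>i. if i \<in> I then g i else 0) \<le> infsum g I"
proof -
  have "(\<Sum>i<n. if i \<in> I then g i else 0) \<le> infsum g I" for n
  proof -
    have "(\<Sum>i<n. if i \<in> I then g i else 0) = sum g ({..<n} \<inter> I)"
      by (simp add: sum.If_cases)
    also have "\<dots> \<le> infsum g I"
      by (subst nonneg_infsum_complete) (auto intro!: SUP_upper)
    finally show ?thesis .
  qed
  then show ?thesis
    unfolding suminf_eq_SUP by (auto intro: SUP_least)
qed

section \<open>Bowen balls and Birkhoff sums\<close>

lemma bowen_ball_eq:
  assumes "0 < n"
  shows "bowen_ball f n x \<epsilon> = {y. \<forall>i<n. dist ((f ^^ i) x) ((f ^^ i) y) < \<epsilon>}"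
  using assms by (subst bowen_ball_def, subst bowen_dist_def, subst Max_less_iff) auto

lemma bowen_ball_mono: "\<epsilon> \<le> \<epsilon>' \<Longrightarrow> bowen_ball f n x \<epsilon> \<subseteq> bowen_ball f n x \<epsilon>'"
  by (auto simp: bowen_ball_def)

lemma bowen_ball_commute:
  assumes "0 < n"
  shows "y \<in> bowen_ball f n x \<epsilon> \<longleftrightarrow> x \<in> bowen_ball f n y \<epsilon>"
  using assms by (simp add: bowen_ball_eq dist_commute)

lemma bowen_ball_self: "\<lbrakk>0 < n; 0 < \<epsilon>\<rbrakk> \<Longrightarrow> x \<in> bowen_ball f n x \<epsilon>"
  by (simp add: bowen_ball_eq)

lemma bowen_ball_triangle:
  assumes n: "0 < n" and y: "y \<in> bowen_ball f n x \<epsilon>"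
  shows "bowen_ball f n y \<epsilon>' \<subseteq> bowen_ball f n x (\<epsilon> + \<epsilon>')"
proof
  fix z assume z: "z \<in> bowen_ball f n y \<epsilon>'"
  show "z \<in> bowen_ball f n x (\<epsilon> + \<epsilon>')"
    unfolding bowen_ball_eq[OF n]
  proof clarify
    fix i assume "i < n"
    then have "dist ((f ^^ i) x) ((f ^^ i) y) < \<epsilon>" "dist ((f ^^ i) y) ((f ^^ i) z) < \<epsilon>'"
      using y z by (auto simp: bowen_ball_eq[OF n])
    then show "dist ((f ^^ i) x) ((f ^^ i) z) < \<epsilon> + \<epsilon>'"
      using dist_triangle[of "(f ^^ i) x" "(f ^^ i) z" "(f ^^ i) y"] by linarith
  qed
qed

lemma continuous_on_funpow:
  fixes f :: "'a::topological_space \<Rightarrow> 'a"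
  assumes "continuous_on UNIV f"
  shows "continuous_on UNIV (f ^^ i)"
  by (induction i) (auto intro: continuous_on_compose2[OF assms] simp: id_def)

lemma open_bowen_ball:
  assumes f: "continuous_on UNIV f" and n: "0 < n"
  shows "open (bowen_ball f n x \<epsilon>)"
proof -
  have "bowen_ball f n x \<epsilon> = (\<Inter>i\<in>{..<n}. {y. dist ((f ^^ i) x) ((f ^^ i) y) < \<epsilon>})"
    by (auto simp: bowen_ball_eq[OF n])
  also have "open \<dots>"
    by (intro open_INT ballI open_Collect_less continuous_intros continuous_on_funpow f) auto
  finally show ?thesis .
qed

text \<open>Bowen balls are defined by a strict inequality, so they are exhausted from inside; radii
  that are not positive only contribute empty balls.\<close>

lemma UN_bowen_ball:
  assumes n: "0 < n"
  shows "(\<Union>k. bowen_ball f n x (\<epsilon> - 1 / real (Suc k))) = bowen_ball f n x \<epsilon>"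
proof (intro equalityI subsetI)
  fix y assume "y \<in> (\<Union>k. bowen_ball f n x (\<epsilon> - 1 / real (Suc k)))"
  then obtain k where "y \<in> bowen_ball f n x (\<epsilon> - 1 / real (Suc k))" by blast
  then show "y \<in> bowen_ball f n x \<epsilon>"
    using bowen_ball_mono[of "\<epsilon> - 1 / real (Suc k)" \<epsilon>] by auto
next
  fix y assume "y \<in> bowen_ball f n x \<epsilon>"
  then have "0 < \<epsilon> - bowen_dist f n x y"
    by (simp add: bowen_ball_def)
  from reals_Archimedean[OF this] obtain k where "1 / real (Suc k) < \<epsilon> - bowen_dist f n x y"
    by (auto simp: inverse_eq_divide)
  then show "y \<in> (\<Union>k. bowen_ball f n x (\<epsilon> - 1 / real (Suc k)))"
    by (auto simp: bowen_ball_def intro!: exI[of _ k])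
qed

text \<open>Each of the \<open>n\<close> orbit points moves by less than \<epsilon>, which costs at
  most \<delta> per summand.\<close>

lemma birkhoff_sum_add_le:
  assumes "y \<in> bowen_ball f n x \<epsilon>" "0 < n"
    and "\<And>u v. dist u v < \<epsilon> \<Longrightarrow> \<phi> v \<le> \<phi> u + \<delta>"
  shows "birkhoff_sum f \<phi> n y \<le> birkhoff_sum f \<phi> n x + \<delta> * real n"
proof -
  have "birkhoff_sum f \<phi> n y \<le> (\<Sum>i<n. \<phi> ((f ^^ i) x) + \<delta>)"
    unfolding birkhoff_sum_def using assms by (intro sum_mono) (auto simp: bowen_ball_eq)
  then show ?thesis
    by (simp add: birkhoff_sum_def sum.distrib mult.commute)
qed

section \<open>Sums over covers\<close>

text \<open>Constructed covers are countable sets of pairs, whereas \<open>cover_sum\<close> admits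
  only families indexed by sets of naturals; an enumeration of \<open>J\<close> translates between
  the two.\<close>

lemma cover_sum_le_infsum:
  fixes J :: "(nat \<times> 'a::metric_space) set"
  assumes J: "countable J" and Z: "Z \<subseteq> (\<Union>(n, x)\<in>J. bowen_ball f n x \<epsilon>)"
    and N: "\<And>n x. (n, x) \<in> J \<Longrightarrow> N \<le> n"
  shows "cover_sum f \<phi> Z \<alpha> N \<epsilon> \<le>
    (\<Sum>\<^sub>\<infinity>(n, x)\<in>J. ennreal (exp (- \<alpha> * real n + birkhoff_sum f \<phi> n x)))"
proof -
  define h where "h = from_nat_into J"
  define I where "I = to_nat_on J ` J"
  have hI: "h (to_nat_on J j) = j" if "j \<in> J" for j
    using J that by (simp add: h_def)
  have bij: "bij_betw h I J"
    by (rule bij_betwI[where g = "to_nat_on J"]) (auto simp: I_def hI)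
  have "(\<Sum>\<^sub>\<infinity>(n, x)\<in>J. ennreal (exp (- \<alpha> * real n + birkhoff_sum f \<phi> n x)))
      = (\<Sum>\<^sub>\<infinity>i\<in>I. ennreal (exp (- \<alpha> * real (fst (h i)) + birkhoff_sum f \<phi> (fst (h i)) (snd (h i)))))"
    by (subst infsum_reindex_bij_betw[OF bij, symmetric]) (simp add: case_prod_beta)
  moreover have "Z \<subseteq> (\<Union>i\<in>I. bowen_ball f (fst (h i)) (snd (h i)) \<epsilon>)"
  proof
    fix z assume "z \<in> Z"
    then obtain j where j: "j \<in> J" "z \<in> bowen_ball f (fst j) (snd j) \<epsilon>"
      using Z by (auto simp: case_prod_beta)
    then show "z \<in> (\<Union>i\<in>I. bowen_ball f (fst (h i)) (snd (h i)) \<epsilon>)"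
      by (intro UN_I[of "to_nat_on J j"]) (auto simp: I_def hI)
  qed
  moreover have "\<forall>i\<in>I. N \<le> fst (h i)"
    using N by (auto simp: I_def hI)
  ultimately show ?thesis
    unfolding cover_sum_def
    by (intro Inf_lower CollectI exI[of _ I] exI[of _ "\<lambda>i. snd (h i)"] exI[of _ "\<lambda>i. fst (h i)"]) auto
qed

lemma le_cover_sumI:
  assumes "\<And>(I :: nat set) x n. \<lbrakk>Z \<subseteq> (\<Union>i\<in>I. bowen_ball f (n i) (x i) \<epsilon>); \<And>i. i \<in> I \<Longrightarrow> N \<le> n i\<rbrakk> \<Longrightarrow>
    c \<le> (\<Sum>\<^sub>\<infinity>i\<in>I. ennreal (exp (- \<alpha> * real (n i) + birkhoff_sum f \<phi> (n i) (x i))))"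
  shows "c \<le> cover_sum f \<phi> Z \<alpha> N \<epsilon>"
  unfolding cover_sum_def using assms by (intro Inf_greatest) blast

lemma incseq_cover_sum: "incseq (\<lambda>N. cover_sum f \<phi> Z \<alpha> N \<epsilon>)"
  unfolding cover_sum_def by (rule monoI, rule Inf_superset_mono) fastforce

text \<open>A larger \<open>N\<close> admits fewer covers, so the limit is a supremum and every
  single \<open>cover_sum\<close> bounds it from below.\<close>

lemma cover_limit_eq_SUP: "cover_limit f \<phi> Z \<alpha> \<epsilon> = (SUP N. cover_sum f \<phi> Z \<alpha> N \<epsilon>)"
  unfolding cover_limit_def by (intro limI LIMSEQ_SUP incseq_cover_sum)

section \<open>Pointwise pressure at a fixed scale\<close>

text \<open>The expression under the liminf in \<open>pointwise_pressure\<close>.\<close>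

definition scale_pressure_seq ::
  "'a::metric_space measure \<Rightarrow> ('a \<Rightarrow> 'a) \<Rightarrow> ('a \<Rightarrow> real) \<Rightarrow> real \<Rightarrow> 'a \<Rightarrow> nat \<Rightarrow> ereal" where
  "scale_pressure_seq \<mu> f \<phi> \<epsilon> x n =
     ereal (1 / real n) * (neg_log (measure \<mu> (bowen_ball f n x \<epsilon>)) + ereal (birkhoff_sum f \<phi> n x))"

text \<open>Trades logarithms for an inequality between measures and exponentials. A null ball
  satisfies both sides: its \<open>neg_log\<close> is infinite, and the exponential is
  positive.\<close>

lemma less_scale_pressure_seq_iff:
  assumes "0 < n"
  shows "ereal s < scale_pressure_seq \<mu> f \<phi> \<epsilon> x n \<longleftrightarrow>
    measure \<mu> (bowen_ball f n x \<epsilon>) < exp (- s * real n + birkhoff_sum f \<phi> n x)"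
proof (cases "measure \<mu> (bowen_ball f n x \<epsilon>) = 0")
  case True
  then show ?thesis using assms by (simp add: scale_pressure_seq_def neg_log_def)
next
  case False
  then have "0 < measure \<mu> (bowen_ball f n x \<epsilon>)"
    by (simp add: zero_less_measure_iff)
  then have "measure \<mu> (bowen_ball f n x \<epsilon>) < exp (- s * real n + birkhoff_sum f \<phi> n x) \<longleftrightarrow>
    ln (measure \<mu> (bowen_ball f n x \<epsilon>)) < - s * real n + birkhoff_sum f \<phi> n x"
    by (metis exp_less_cancel_iff exp_ln)
  then show ?thesis using assms False
    by (auto simp: scale_pressure_seq_def neg_log_def field_simps)
qed

lemma neg_log_antimono: "\<lbrakk>0 \<le> p; p \<le> q\<rbrakk> \<Longrightarrow> neg_log q \<le> neg_log p"
  by (auto simp: neg_log_def)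

locale compact_borel_system = prob_space \<mu> for \<mu> :: "'a::metric_space measure" +
  fixes f :: "'a \<Rightarrow> 'a" and \<phi> :: "'a \<Rightarrow> real"
  assumes compact_UNIV: "compact (UNIV :: 'a set)"
    and continuous_map: "continuous_on UNIV f"
    and continuous_potential: "continuous_on UNIV \<phi>"
    and sets_eq_borel: "sets \<mu> = sets borel"
begin

lemma space_eq_UNIV: "space \<mu> = UNIV"
  using sets_eq_imp_space_eq[OF sets_eq_borel] by simp

lemma sets_bowen_ball: "0 < n \<Longrightarrow> bowen_ball f n x \<epsilon> \<in> sets \<mu>"
  by (simp add: sets_eq_borel open_bowen_ball continuous_map)

lemma scale_pressure_seq_antimono:
  assumes "a \<le> b"
  shows "scale_pressure_seq \<mu> f \<phi> b x n \<le> scale_pressure_seq \<mu> f \<phi> a x n"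
proof (cases "n = 0")
  case True
  \<comment> \<open>The factor \<open>1 / real 0\<close> is \<open>0\<close>, which annihilates even
    an infinite bracket, so the unspecified ball for \<open>n = 0\<close> does not matter.\<close>
  then show ?thesis by (simp add: scale_pressure_seq_def flip: zero_ereal_def)
next
  case False
  then have "measure \<mu> (bowen_ball f n x a) \<le> measure \<mu> (bowen_ball f n x b)"
    by (intro finite_measure_mono bowen_ball_mono sets_bowen_ball assms) auto
  then show ?thesis
    unfolding scale_pressure_seq_def
    by (intro ereal_mult_left_mono add_mono neg_log_antimono) auto
qed

lemma tendsto_pointwise_pressure:
  "((\<lambda>\<epsilon>. liminf (scale_pressure_seq \<mu> f \<phi> \<epsilon> x)) \<longlongrightarrow>
    (SUP k. liminf (scale_pressure_seq \<mu> f \<phi> (1 / real (Suc k)) x))) (at_right 0)"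
  by (intro tendsto_at_right_0_antimono_SUP Liminf_mono always_eventually allI
      scale_pressure_seq_antimono)

lemma pointwise_pressure_eq_SUP:
  "pointwise_pressure \<mu> f \<phi> x = (SUP k. liminf (scale_pressure_seq \<mu> f \<phi> (1 / real (Suc k)) x))"
  using tendsto_Lim[OF _ tendsto_pointwise_pressure]
  by (simp add: pointwise_pressure_def scale_pressure_seq_def[abs_def])

lemma liminf_le_pointwise_pressure:
  assumes "0 < \<epsilon>"
  shows "liminf (scale_pressure_seq \<mu> f \<phi> \<epsilon> x) \<le> pointwise_pressure \<mu> f \<phi> x"
proof -
  obtain k where "1 / real (Suc k) < \<epsilon>"
    using reals_Archimedean[OF assms] by (auto simp: inverse_eq_divide)
  then show ?thesis
    unfolding pointwise_pressure_eq_SUP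
    by (intro SUP_upper2[of k] Liminf_mono always_eventually allI scale_pressure_seq_antimono) auto
qed

section \<open>Measurability of the pointwise pressure\<close>

text \<open>Lower semicontinuity in the centre: by continuity from below a slightly smaller ball
  around \<open>x\<close> still has measure above \<open>a\<close>, and it stays inside the full
  ball around any centre within the radius given up.\<close>

lemma open_measure_bowen_ball_greater:
  assumes n: "0 < n"
  shows "open {x. a < measure \<mu> (bowen_ball f n x \<epsilon>)}"
proof (subst open_subopen, intro ballI)
  fix x assume "x \<in> {x. a < measure \<mu> (bowen_ball f n x \<epsilon>)}"
  then have a: "a < measure \<mu> (bowen_ball f n x \<epsilon>)" by simp
  have "(\<lambda>k. measure \<mu> (bowen_ball f n x (\<epsilon> - 1 / real (Suc k)))) \<longlonglongrightarrow>
      measure \<mu> (\<Union>k. bowen_ball f n x (\<epsilon> - 1 / real (Suc k)))"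
  proof (rule finite_Lim_measure_incseq)
    show "range (\<lambda>k. bowen_ball f n x (\<epsilon> - 1 / real (Suc k))) \<subseteq> sets \<mu>"
      using n by (auto intro: sets_bowen_ball)
    show "incseq (\<lambda>k. bowen_ball f n x (\<epsilon> - 1 / real (Suc k)))"
      by (rule monoI, rule bowen_ball_mono) (auto simp: frac_le)
  qed
  then have "\<forall>\<^sub>F k in sequentially. a < measure \<mu> (bowen_ball f n x (\<epsilon> - 1 / real (Suc k)))"
    using a unfolding UN_bowen_ball[OF n] by (rule order_tendstoD)
  then obtain k where k: "a < measure \<mu> (bowen_ball f n x (\<epsilon> - 1 / real (Suc k)))"
    by (auto simp: eventually_sequentially)
  let ?U = "bowen_ball f n x (1 / real (Suc k))"
  have "a < measure \<mu> (bowen_ball f n y \<epsilon>)" if "y \<in> ?U" for y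
  proof -
    have "x \<in> bowen_ball f n y (1 / real (Suc k))"
      using that bowen_ball_commute[OF n] by blast
    from bowen_ball_triangle[OF n this, of "\<epsilon> - 1 / real (Suc k)"]
    have "bowen_ball f n x (\<epsilon> - 1 / real (Suc k)) \<subseteq> bowen_ball f n y \<epsilon>"
      by simp
    then show ?thesis
      using k n finite_measure_mono sets_bowen_ball by (meson less_le_trans)
  qed
  moreover have "open ?U" "x \<in> ?U"
    using n continuous_map by (auto intro: open_bowen_ball bowen_ball_self)
  ultimately show "\<exists>T. open T \<and> x \<in> T \<and> T \<subseteq> {x. a < measure \<mu> (bowen_ball f n x \<epsilon>)}"
    by blast
qed

lemma measurable_measure_bowen_ball:
  "0 < n \<Longrightarrow> (\<lambda>x. measure \<mu> (bowen_ball f n x \<epsilon>)) \<in> borel_measurable \<mu>"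
  by (rule borel_measurableI_greater)
    (simp add: space_eq_UNIV sets_eq_borel open_measure_bowen_ball_greater)

lemma measurable_birkhoff_sum: "birkhoff_sum f \<phi> n \<in> borel_measurable \<mu>"
proof -
  have "continuous_on UNIV (birkhoff_sum f \<phi> n)"
    unfolding birkhoff_sum_def[abs_def]
    by (intro continuous_intros continuous_on_compose2[OF continuous_potential]
        continuous_on_funpow continuous_map) auto
  then have "birkhoff_sum f \<phi> n \<in> borel_measurable borel"
    by (rule borel_measurable_continuous_onI)
  then show ?thesis
    by (simp add: measurable_cong_sets[OF sets_eq_borel refl])
qed

lemma measurable_scale_pressure_seq:
  "(\<lambda>x. scale_pressure_seq \<mu> f \<phi> \<epsilon> x n) \<in> borel_measurable \<mu>"
proof (cases "n = 0")
  case True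
  then show ?thesis by (simp add: scale_pressure_seq_def flip: zero_ereal_def)
next
  case False
  then have [measurable]: "(\<lambda>x. measure \<mu> (bowen_ball f n x \<epsilon>)) \<in> borel_measurable \<mu>"
    "birkhoff_sum f \<phi> n \<in> borel_measurable \<mu>"
    by (auto intro: measurable_measure_bowen_ball measurable_birkhoff_sum)
  show ?thesis
    unfolding scale_pressure_seq_def neg_log_def by measurable
qed

lemma measurable_pointwise_pressure: "pointwise_pressure \<mu> f \<phi> \<in> borel_measurable \<mu>"
  unfolding pointwise_pressure_eq_SUP[abs_def]
  by (intro borel_measurable_SUP borel_measurable_liminf measurable_scale_pressure_seq) auto

section \<open>Upper bound: covers by heavy balls\<close>

text \<open>For fixed \<open>n\<close> this keeps the weights \<open>exp (- s n + S_n)\<close> away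
  from \<open>0\<close>, which bounds the size of the separated sets below.\<close>

lemma bounded_birkhoff_sum: "\<exists>C. \<forall>x. C \<le> birkhoff_sum f \<phi> n x"
proof -
  have "bounded (range \<phi>)"
    using compact_UNIV continuous_potential
    by (intro compact_imp_bounded compact_continuous_image)
  then obtain B where B: "\<And>x. \<bar>\<phi> x\<bar> \<le> B"
    by (auto simp: bounded_iff)
  have "(\<Sum>i<n. - B) \<le> birkhoff_sum f \<phi> n x" for x
    unfolding birkhoff_sum_def by (intro sum_mono) (metis B abs_le_D2 minus_le_iff)
  then show ?thesis by blast
qed

text \<open>Take a set of centres in \<open>Z\<close> with disjoint balls and greatest cardinality.
  Disjointness bounds the total weight by the total mass \<open>1\<close>; a point outside all
  doubled balls could be added as a further centre.\<close>

lemma heavy_balls_cover: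
  assumes n: "0 < n" and \<epsilon>: "0 < \<epsilon>"
    and Z: "\<And>x. x \<in> Z \<Longrightarrow> exp (- s * real n + birkhoff_sum f \<phi> n x) \<le> measure \<mu> (bowen_ball f n x \<epsilon>)"
  obtains E where "finite E" "Z \<subseteq> (\<Union>x\<in>E. bowen_ball f n x (2 * \<epsilon>))"
    "(\<Sum>x\<in>E. exp (- s * real n + birkhoff_sum f \<phi> n x)) \<le> 1"
proof -
  define sep where "sep E \<longleftrightarrow> finite E \<and> E \<subseteq> Z \<and>
    disjoint_family_on (\<lambda>x. bowen_ball f n x \<epsilon>) E" for E
  have total: "(\<Sum>x\<in>E. exp (- s * real n + birkhoff_sum f \<phi> n x)) \<le> 1" if "sep E" for E
  proof -
    have "(\<Sum>x\<in>E. exp (- s * real n + birkhoff_sum f \<phi> n x)) \<le> (\<Sum>x\<in>E. measure \<mu> (bowen_ball f n x \<epsilon>))"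
      using that Z by (intro sum_mono) (auto simp: sep_def)
    also have "\<dots> = measure \<mu> (\<Union>x\<in>E. bowen_ball f n x \<epsilon>)"
      using that n by (intro finite_measure_finite_Union[symmetric]) (auto simp: sep_def sets_bowen_ball)
    also have "\<dots> \<le> 1" by simp
    finally show ?thesis .
  qed
  obtain C where C: "\<And>x. C \<le> birkhoff_sum f \<phi> n x"
    using bounded_birkhoff_sum by blast
  \<comment> \<open>The total weight is at most \<open>1\<close> and each weight is at least
    \<open>exp (- s n + C)\<close>; this bound on the cardinality is what makes a largest set
    exist.\<close>
  have card: "card E < Suc (nat \<lceil>1 / exp (- s * real n + C)\<rceil>)" if "sep E" for E
  proof -
    have "real (card E) * exp (- s * real n + C) \<le> (\<Sum>x\<in>E. exp (- s * real n + birkhoff_sum f \<phi> n x))"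
      using C by (intro sum_bounded_below) auto
    also note total[OF that]
    finally have "real (card E) \<le> 1 / exp (- s * real n + C)"
      by (simp add: field_simps)
    then show ?thesis by linarith
  qed
  have "sep {}" by (simp add: sep_def disjoint_family_on_def)
  then obtain E where E: "sep E" and max: "\<And>E'. sep E' \<Longrightarrow> card E' \<le> card E"
    using ex_has_greatest_nat[of sep "{}" card] card by blast
  have "Z \<subseteq> (\<Union>x\<in>E. bowen_ball f n x (2 * \<epsilon>))"
  proof (rule ccontr)
    assume "\<not> ?thesis"
    then obtain z where z: "z \<in> Z" "\<And>x. x \<in> E \<Longrightarrow> z \<notin> bowen_ball f n x (2 * \<epsilon>)"
      by blast
    have disj: "bowen_ball f n x \<epsilon> \<inter> bowen_ball f n z \<epsilon> = {}" if "x \<in> E" for x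
    proof (rule ccontr)
      assume "bowen_ball f n x \<epsilon> \<inter> bowen_ball f n z \<epsilon> \<noteq> {}"
      then obtain y where y: "y \<in> bowen_ball f n x \<epsilon>" "z \<in> bowen_ball f n y \<epsilon>"
        using bowen_ball_commute[OF n] by blast
      then show False
        using bowen_ball_triangle[OF n y(1), of \<epsilon>] z(2)[OF that] by auto
    qed
    \<comment> \<open>Otherwise \<open>z\<close> would lie in its own doubled ball; thus inserting
      \<open>z\<close> really raises the cardinality.\<close>
    have "z \<notin> E"
      using z(2)[of z] bowen_ball_self[OF n, of "2 * \<epsilon>"] \<epsilon> by auto
    moreover from this have "sep (insert z E)"
      using E z(1) disj by (auto simp: sep_def disjoint_family_on_insert)
    ultimately show False
      using max[of "insert z E"] E by (simp add: sep_def)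
  qed
  then show thesis
    using that E total by (auto simp: sep_def)
qed

text \<open>A liminf below \<open>s\<close> puts each point of \<open>Z\<close> into
  \<open>H n\<close> for arbitrarily large \<open>n\<close>, so the covers of all \<open>H n\<close>
  with \<open>n \<ge> N\<close> together cover \<open>Z\<close>. Passing from \<open>s\<close> to
  \<open>t\<close> multiplies the weights at level \<open>n\<close> by \<open>r ^ n\<close>, and a
  geometric tail remains.\<close>

lemma pressure_on_scale_le:
  assumes \<epsilon>: "0 < \<epsilon>" and st: "s < t"
    and Z: "\<And>x. x \<in> Z \<Longrightarrow> liminf (scale_pressure_seq \<mu> f \<phi> \<epsilon> x) < ereal s"
  shows "pressure_on_scale f \<phi> Z (2 * \<epsilon>) \<le> ereal t"
proof -
  define r where "r = exp (- (t - s))"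
  have r: "0 < r" "r < 1" using st by (auto simp: r_def)
  define H where "H n = {x. exp (- s * real n + birkhoff_sum f \<phi> n x) \<le> measure \<mu> (bowen_ball f n x \<epsilon>)}" for n
  have "\<exists>E. finite E \<and> H n \<subseteq> (\<Union>x\<in>E. bowen_ball f n x (2 * \<epsilon>)) \<and>
      (\<Sum>x\<in>E. exp (- s * real n + birkhoff_sum f \<phi> n x)) \<le> 1" if "0 < n" for n
    by (rule heavy_balls_cover[OF that \<epsilon>, of "H n" s]) (auto simp: H_def)
  then obtain E where fin: "\<And>n. 0 < n \<Longrightarrow> finite (E n)"
    and cov: "\<And>n. 0 < n \<Longrightarrow> H n \<subseteq> (\<Union>x\<in>E n. bowen_ball f n x (2 * \<epsilon>))"
    and tot: "\<And>n. 0 < n \<Longrightarrow> (\<Sum>x\<in>E n. exp (- s * real n + birkhoff_sum f \<phi> n x)) \<le> 1"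
    by metis
  have bound: "cover_sum f \<phi> Z t N (2 * \<epsilon>) \<le> ennreal (r ^ N / (1 - r))" if N: "0 < N" for N
  proof -
    define J where "J = (SIGMA n:{N..}. E n)"
    have "countable J"
      unfolding J_def using fin N by (intro countable_SIGMA) (auto intro: countable_finite)
    moreover have "Z \<subseteq> (\<Union>(n, x)\<in>J. bowen_ball f n x (2 * \<epsilon>))"
    proof
      fix x assume "x \<in> Z"
      have "\<exists>n\<ge>N. \<not> ereal s < scale_pressure_seq \<mu> f \<phi> \<epsilon> x n"
      proof (rule ccontr)
        assume "\<not> ?thesis"
        then have "\<forall>\<^sub>F n in sequentially. ereal s \<le> scale_pressure_seq \<mu> f \<phi> \<epsilon> x n"
          unfolding eventually_sequentially by (auto intro!: exI[of _ N] less_imp_le)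
        then have "ereal s \<le> liminf (scale_pressure_seq \<mu> f \<phi> \<epsilon> x)"
          by (rule Liminf_bounded)
        then show False using Z[OF \<open>x \<in> Z\<close>] by simp
      qed
      then obtain n where n: "N \<le> n" "\<not> ereal s < scale_pressure_seq \<mu> f \<phi> \<epsilon> x n"
        by blast
      then have "x \<in> H n"
        using N less_scale_pressure_seq_iff[of n s \<mu> f \<phi> \<epsilon> x] by (simp add: H_def)
      then obtain y where "y \<in> E n" "x \<in> bowen_ball f n y (2 * \<epsilon>)"
        using cov[of n] N n(1) by auto
      then show "x \<in> (\<Union>(n, x)\<in>J. bowen_ball f n x (2 * \<epsilon>))"
        using n(1) by (intro UN_I[of "(n, y)"]) (auto simp: J_def)
    qed
    ultimately have "cover_sum f \<phi> Z t N (2 * \<epsilon>) \<le>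
        (\<Sum>\<^sub>\<infinity>(n, x)\<in>J. ennreal (exp (- t * real n + birkhoff_sum f \<phi> n x)))"
      by (rule cover_sum_le_infsum) (auto simp: J_def)
    also have "\<dots> \<le> ennreal (r ^ N / (1 - r))"
    proof (rule infsum_ennreal_le)
      fix F assume F: "finite F" "F \<subseteq> J"
      have level: "(\<Sum>x\<in>E n. exp (- t * real n + birkhoff_sum f \<phi> n x)) \<le> r ^ n" if "0 < n" for n
      proof -
        have "(\<Sum>x\<in>E n. exp (- t * real n + birkhoff_sum f \<phi> n x)) =
            r ^ n * (\<Sum>x\<in>E n. exp (- s * real n + birkhoff_sum f \<phi> n x))"
          unfolding sum_distrib_left
          by (intro sum.cong) (auto simp: r_def exp_of_nat_mult[symmetric] exp_add[symmetric] algebra_simps)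
        also have "\<dots> \<le> r ^ n"
          using tot[OF that] r by (intro mult_left_le) auto
        finally show ?thesis .
      qed
      \<comment> \<open>A finite part of \<open>J\<close> meets only finitely many levels, so its
        sum is dominated by an iterated finite sum.\<close>
      obtain K where K: "\<forall>n\<in>fst ` F. n < K"
        using F(1) finite_nat_set_iff_bounded by (metis finite_imageI)
      have "F \<subseteq> (SIGMA n:{N..<K}. E n)"
        using F(2) K by (fastforce simp: J_def)
      then have "(\<Sum>(n, x)\<in>F. exp (- t * real n + birkhoff_sum f \<phi> n x)) \<le>
          (\<Sum>(n, x)\<in>(SIGMA n:{N..<K}. E n). exp (- t * real n + birkhoff_sum f \<phi> n x))"
        using fin N by (intro sum_mono2) auto
      also have "\<dots> = (\<Sum>n\<in>{N..<K}. \<Sum>x\<in>E n. exp (- t * real n + birkhoff_sum f \<phi> n x))"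
        using fin N by (intro sum.Sigma[symmetric]) auto
      also have "\<dots> \<le> (\<Sum>n\<in>{N..<K}. r ^ n)"
        using N by (intro sum_mono level) auto
      also have "\<dots> \<le> r ^ N / (1 - r)"
      proof (cases "N \<le> K")
        case True
        \<comment> \<open>The sum telescopes; the signs are arranged to match the form of
          \<open>sum_Suc_diff'\<close>.\<close>
        have "(1 - r) * (\<Sum>n\<in>{N..<K}. r ^ n) = (\<Sum>n\<in>{N..<K}. (- (r ^ Suc n)) - (- (r ^ n)))"
          unfolding sum_distrib_left by (intro sum.cong) (auto simp: algebra_simps)
        also have "\<dots> = r ^ N - r ^ K"
          using True by (subst sum_Suc_diff') auto
        also have "\<dots> \<le> r ^ N" using r by simp
        finally show ?thesis using r by (simp add: pos_le_divide_eq mult.commute)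
      qed (use r in auto)
      finally show "(\<Sum>(n, x)\<in>F. ennreal (exp (- t * real n + birkhoff_sum f \<phi> n x))) \<le>
          ennreal (r ^ N / (1 - r))"
        by (simp add: case_prod_beta sum_ennreal ennreal_leI)
    qed
    finally show ?thesis .
  qed
  have "cover_limit f \<phi> Z t (2 * \<epsilon>) = 0"
  proof -
    have "(\<lambda>N. r ^ N / (1 - r)) \<longlonglongrightarrow> 0"
      using r by (intro tendsto_divide_zero LIMSEQ_realpow_zero) auto
    then have lim: "(\<lambda>N. ennreal (r ^ N / (1 - r))) \<longlonglongrightarrow> 0"
      using tendsto_ennrealI by fastforce
    have "\<forall>\<^sub>F N in sequentially. cover_sum f \<phi> Z t N (2 * \<epsilon>) \<le> ennreal (r ^ N / (1 - r))"
      using eventually_gt_at_top[of 0] by eventually_elim (rule bound)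
    then have "(\<lambda>N. cover_sum f \<phi> Z t N (2 * \<epsilon>)) \<longlonglongrightarrow> 0"
      by (rule tendsto_sandwich[OF always_eventually[OF allI[OF zero_le]] _ tendsto_const lim])
    then show ?thesis
      unfolding cover_limit_def by (rule limI)
  qed
  then show ?thesis
    unfolding pressure_on_scale_def by (auto intro: Inf_lower)
qed

text \<open>The set where the pointwise pressure is at most its essential supremum has full measure,
  hence competes in the infimum. On it the liminf at every positive scale is below any
  \<open>s\<close> greater than the essential supremum.\<close>

lemma measure_pressure_scale_le_esssup:
  assumes \<epsilon>: "0 < \<epsilon>"
  shows "measure_pressure_scale \<mu> f \<phi> \<epsilon> \<le> esssup \<mu> (pointwise_pressure \<mu> f \<phi>)" (is "_ \<le> ?E")
proof -
  have [measurable]: "pointwise_pressure \<mu> f \<phi> \<in> borel_measurable \<mu>"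
    by (rule measurable_pointwise_pressure)
  define Z where "Z = {x \<in> space \<mu>. pointwise_pressure \<mu> f \<phi> x \<le> ?E}"
  have Z: "Z \<in> sets \<mu>" "emeasure \<mu> Z = 1"
    unfolding Z_def using esssup_AE[of "pointwise_pressure \<mu> f \<phi>" \<mu>]
    by (auto intro!: emeasure_eq_1_AE)
  have "pressure_on_scale f \<phi> Z \<epsilon> \<le> ?E"
  proof (rule dense_ge)
    fix b assume "?E < b"
    \<comment> \<open>Two reals are inserted: \<open>s\<close> makes the bound on the liminf strict,
      and the gap from \<open>s\<close> to \<open>t\<close> makes the series over the levels
      converge.\<close>
    then obtain s where s: "?E < ereal s" "ereal s < b" using ereal_dense2 by blast
    then obtain t where t: "ereal s < ereal t" "ereal t < b" using ereal_dense2 by blast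
    \<comment> \<open>The scale is halved because the cover uses balls of twice the radius.\<close>
    have "pressure_on_scale f \<phi> Z (2 * (\<epsilon> / 2)) \<le> ereal t"
    proof (rule pressure_on_scale_le)
      fix x assume "x \<in> Z"
      then have "liminf (scale_pressure_seq \<mu> f \<phi> (\<epsilon> / 2) x) \<le> ?E"
        using liminf_le_pointwise_pressure[of "\<epsilon> / 2" x] \<epsilon> by (auto simp: Z_def)
      then show "liminf (scale_pressure_seq \<mu> f \<phi> (\<epsilon> / 2) x) < ereal s"
        using s(1) by simp
    qed (use \<epsilon> t in auto)
    then show "pressure_on_scale f \<phi> Z \<epsilon> \<le> b"
      using t by simp
  qed
  moreover have "measure_pressure_scale \<mu> f \<phi> \<epsilon> \<le> pressure_on_scale f \<phi> Z \<epsilon>"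
    unfolding measure_pressure_scale_def using Z by (auto intro: Inf_lower)
  ultimately show ?thesis by simp
qed

section \<open>Lower bound: mass distribution\<close>

text \<open>A covering ball that meets \<open>A\<close> at \<open>y\<close> lies in the ball of
  twice the radius around \<open>y\<close>, which is light. Replacing \<open>y\<close> by the
  original centre in the Birkhoff sum costs \<delta> per unit of time, which the gap between
  \<alpha> and \<open>s\<close> absorbs.\<close>

lemma emeasure_le_cover_sum:
  assumes A: "A \<in> sets \<mu>" and Z: "A \<subseteq> Z" and N: "0 < N" and \<alpha>: "\<alpha> \<le> s - \<delta>"
    and light: "\<And>x n. \<lbrakk>x \<in> A; N \<le> n\<rbrakk> \<Longrightarrow>
      measure \<mu> (bowen_ball f n x (2 * \<epsilon>)) \<le> exp (- s * real n + birkhoff_sum f \<phi> n x)"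
    and \<phi>: "\<And>u v. dist u v < \<epsilon> \<Longrightarrow> \<phi> v \<le> \<phi> u + \<delta>"
  shows "emeasure \<mu> A \<le> cover_sum f \<phi> Z \<alpha> N \<epsilon>"
proof (rule le_cover_sumI)
  fix I :: "nat set" and x n
  assume cov: "Z \<subseteq> (\<Union>i\<in>I. bowen_ball f (n i) (x i) \<epsilon>)" and nN: "\<And>i. i \<in> I \<Longrightarrow> N \<le> n i"
  let ?t = "\<lambda>i. ennreal (exp (- \<alpha> * real (n i) + birkhoff_sum f \<phi> (n i) (x i)))"
  \<comment> \<open>Balls that miss \<open>A\<close> are dropped, since \<open>light\<close> says
    nothing about them. The empty set at all other indices gives a sequence over all naturals, as
    countable subadditivity requires.\<close>
  define B where "B i = (if i \<in> I \<and> A \<inter> bowen_ball f (n i) (x i) \<epsilon> \<noteq> {}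
    then bowen_ball f (n i) (x i) \<epsilon> else {})" for i
  have pos: "0 < n i" if "i \<in> I" for i
    using nN[OF that] N by simp
  have Bsets: "range B \<subseteq> sets \<mu>"
    by (auto simp: B_def intro: sets_bowen_ball pos)
  have "A \<subseteq> (\<Union>i. B i)"
    using Z cov by (fastforce simp: B_def)
  then have "emeasure \<mu> A \<le> emeasure \<mu> (\<Union>i. B i)"
    using Bsets by (intro emeasure_mono) auto
  also have "\<dots> \<le> (\<Sum>i. emeasure \<mu> (B i))"
    by (rule emeasure_subadditive_countably[OF Bsets])
  also have "\<dots> \<le> (\<Sum>i. if i \<in> I then ?t i else 0)"
  proof (intro suminf_le allI)
    fix i
    show "emeasure \<mu> (B i) \<le> (if i \<in> I then ?t i else 0)"
    proof (cases "i \<in> I \<and> A \<inter> bowen_ball f (n i) (x i) \<epsilon> \<noteq> {}")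
      case True
      then obtain y where y: "y \<in> A" "y \<in> bowen_ball f (n i) (x i) \<epsilon>" by blast
      have n: "0 < n i" using True pos by simp
      have "bowen_ball f (n i) (x i) \<epsilon> \<subseteq> bowen_ball f (n i) y (\<epsilon> + \<epsilon>)"
        using y(2) bowen_ball_commute[OF n] by (intro bowen_ball_triangle n) blast
      then have "measure \<mu> (bowen_ball f (n i) (x i) \<epsilon>) \<le> measure \<mu> (bowen_ball f (n i) y (2 * \<epsilon>))"
        using n by (intro finite_measure_mono sets_bowen_ball) (auto simp flip: mult_2)
      also have "\<dots> \<le> exp (- s * real (n i) + birkhoff_sum f \<phi> (n i) y)"
        using True by (intro light y nN) auto
      also have "\<dots> \<le> exp (- \<alpha> * real (n i) + birkhoff_sum f \<phi> (n i) (x i))"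
      proof -
        have "birkhoff_sum f \<phi> (n i) y \<le> birkhoff_sum f \<phi> (n i) (x i) + \<delta> * real (n i)"
          by (rule birkhoff_sum_add_le[OF y(2) n \<phi>])
        moreover have "\<alpha> * real (n i) \<le> (s - \<delta>) * real (n i)"
          using \<alpha> by (intro mult_right_mono) auto
        ultimately show ?thesis by (simp add: algebra_simps)
      qed
      finally show ?thesis
        using True by (simp add: B_def emeasure_eq_measure ennreal_leI)
    next
      case False
      then have "B i = {}" unfolding B_def by (rule if_not_P)
      then show ?thesis by simp
    qed
  qed auto
  also have "\<dots> \<le> (\<Sum>\<^sub>\<infinity>i\<in>I. ?t i)"
    by (rule suminf_le_infsum_ennreal)
  finally show "emeasure \<mu> A \<le> (\<Sum>\<^sub>\<infinity>i\<in>I. ?t i)" .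
qed

text \<open>The sets \<open>A k N\<close> fix a scale and a starting time. They are countably many,
  so if all were null, almost every point would have liminf at most \<open>s\<close> at each scale
  \<open>1 / (k + 1)\<close>, hence pointwise pressure at most \<open>s\<close>.\<close>

lemma light_set_of_positive_measure:
  assumes "ereal s < esssup \<mu> (pointwise_pressure \<mu> f \<phi>)"
  obtains A N \<epsilon> where "A \<in> sets \<mu>" "0 < emeasure \<mu> A" "0 < N" "0 < \<epsilon>"
    "\<And>x n. \<lbrakk>x \<in> A; N \<le> n\<rbrakk> \<Longrightarrow>
      measure \<mu> (bowen_ball f n x \<epsilon>) < exp (- s * real n + birkhoff_sum f \<phi> n x)"
proof -
  have [measurable]: "(\<lambda>x. scale_pressure_seq \<mu> f \<phi> e x n) \<in> borel_measurable \<mu>" for e n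
    by (rule measurable_scale_pressure_seq)
  \<comment> \<open>Starting at \<open>Suc N\<close> keeps \<open>n\<close> positive, as
    \<open>less_scale_pressure_seq_iff\<close> requires.\<close>
  define A where "A k N = {x \<in> space \<mu>. \<forall>n\<ge>Suc N. ereal s < scale_pressure_seq \<mu> f \<phi> (1 / real (Suc k)) x n}" for k N
  have A: "A k N \<in> sets \<mu>" for k N
    unfolding A_def by measurable
  have "\<exists>k N. emeasure \<mu> (A k N) \<noteq> 0"
  proof (rule ccontr)
    assume "\<not> ?thesis"
    then have "A k N \<in> null_sets \<mu>" for k N using A by auto
    then have "AE x in \<mu>. \<forall>k N. x \<notin> A k N"
      by (simp add: AE_all_countable AE_not_in)
    moreover have "pointwise_pressure \<mu> f \<phi> x \<le> ereal s" if x: "\<forall>k N. x \<notin> A k N" for x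
      unfolding pointwise_pressure_eq_SUP
    proof (rule SUP_least, rule ccontr)
      fix k assume "\<not> liminf (scale_pressure_seq \<mu> f \<phi> (1 / real (Suc k)) x) \<le> ereal s"
      then have "\<forall>\<^sub>F n in sequentially. ereal s < scale_pressure_seq \<mu> f \<phi> (1 / real (Suc k)) x n"
        by (intro less_LiminfD) auto
      then obtain N where "\<And>n. N \<le> n \<Longrightarrow> ereal s < scale_pressure_seq \<mu> f \<phi> (1 / real (Suc k)) x n"
        unfolding eventually_sequentially by blast
      then have "x \<in> A k N"
        by (simp add: A_def space_eq_UNIV)
      then show False using x by blast
    qed
    ultimately have "AE x in \<mu>. pointwise_pressure \<mu> f \<phi> x \<le> ereal s"
      by (auto elim: eventually_mono)
    then have "esssup \<mu> (pointwise_pressure \<mu> f \<phi>) \<le> ereal s"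
      by (intro esssup_I measurable_pointwise_pressure)
    then show False using assms by simp
  qed
  then obtain k N where "emeasure \<mu> (A k N) \<noteq> 0" by blast
  show thesis
  proof (rule that)
    show "A k N \<in> sets \<mu>" by (rule A)
    show "0 < emeasure \<mu> (A k N)" using \<open>emeasure \<mu> (A k N) \<noteq> 0\<close> by (simp add: zero_less_iff_neq_zero)
    show "0 < Suc N" "0 < 1 / real (Suc k)" by auto
    show "measure \<mu> (bowen_ball f n x (1 / real (Suc k))) < exp (- s * real n + birkhoff_sum f \<phi> n x)"
      if "x \<in> A k N" "Suc N \<le> n" for x n
      using that by (subst less_scale_pressure_seq_iff[symmetric]) (auto simp: A_def)
  qed
qed

text \<open>A set \<open>Z\<close> of full measure contains almost all of the light set
  \<open>A\<close>, so for exponents below \<open>s - \<delta>\<close> its cover sums stay above the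
  positive measure of \<open>A\<close> and the cover limit cannot vanish.\<close>

lemma eventually_le_measure_pressure_scale:
  assumes "ereal s < esssup \<mu> (pointwise_pressure \<mu> f \<phi>)" and \<delta>: "0 < \<delta>"
  shows "\<forall>\<^sub>F \<epsilon> in at_right 0. ereal (s - \<delta>) \<le> measure_pressure_scale \<mu> f \<phi> \<epsilon>"
proof -
  obtain A N \<epsilon>\<^sub>0 where A: "A \<in> sets \<mu>" "0 < emeasure \<mu> A" and N: "0 < N" and \<epsilon>\<^sub>0: "0 < \<epsilon>\<^sub>0"
    and light: "\<And>x n. \<lbrakk>x \<in> A; N \<le> n\<rbrakk> \<Longrightarrow>
      measure \<mu> (bowen_ball f n x \<epsilon>\<^sub>0) < exp (- s * real n + birkhoff_sum f \<phi> n x)"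
    using light_set_of_positive_measure[OF assms(1)] by blast
  have "uniformly_continuous_on UNIV \<phi>"
    by (rule compact_uniformly_continuous[OF continuous_potential compact_UNIV])
  then obtain \<eta> where \<eta>: "0 < \<eta>" "\<And>u v. dist u v < \<eta> \<Longrightarrow> dist (\<phi> u) (\<phi> v) < \<delta>"
    unfolding uniformly_continuous_on_def using \<delta> by (metis UNIV_I dist_commute)
  \<comment> \<open>Below \<eta> the potential varies by less than \<delta> on a ball; below half of
    \<open>\<epsilon>\<^sub>0\<close> the doubled balls are still light.\<close>
  have "ereal (s - \<delta>) \<le> measure_pressure_scale \<mu> f \<phi> \<epsilon>" if \<epsilon>: "0 < \<epsilon>" "\<epsilon> < min \<eta> (\<epsilon>\<^sub>0 / 2)" for \<epsilon>
  proof -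
    have \<phi>: "\<phi> v \<le> \<phi> u + \<delta>" if "dist u v < \<epsilon>" for u v
      using \<eta>(2)[of u v] that \<epsilon> by (auto simp: dist_real_def)
    have light': "measure \<mu> (bowen_ball f n x (2 * \<epsilon>)) \<le> exp (- s * real n + birkhoff_sum f \<phi> n x)"
      if "x \<in> A" "N \<le> n" for x n
    proof -
      have "measure \<mu> (bowen_ball f n x (2 * \<epsilon>)) \<le> measure \<mu> (bowen_ball f n x \<epsilon>\<^sub>0)"
        using \<epsilon> N that by (intro finite_measure_mono bowen_ball_mono sets_bowen_ball) auto
      then show ?thesis using light[OF that] by simp
    qed
    have "s - \<delta> \<le> \<alpha>" if Z: "Z \<in> sets \<mu>" "emeasure \<mu> Z = 1" and \<alpha>: "cover_limit f \<phi> Z \<alpha> \<epsilon> = 0" for Z \<alpha>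
    proof (rule ccontr)
      assume "\<not> s - \<delta> \<le> \<alpha>"
      have "AE x in \<mu>. x \<in> Z"
        using Z by (simp add: AE_in_set_eq_1 emeasure_eq_measure)
      then have "emeasure \<mu> A = emeasure \<mu> (A \<inter> Z)"
        using A Z by (intro emeasure_eq_AE) auto
      also have "\<dots> \<le> cover_sum f \<phi> Z \<alpha> N \<epsilon>"
        using A Z N \<open>\<not> s - \<delta> \<le> \<alpha>\<close>
        by (intro emeasure_le_cover_sum[of _ _ _ _ s \<delta>] light' \<phi>) auto
      also have "\<dots> \<le> cover_limit f \<phi> Z \<alpha> \<epsilon>"
        unfolding cover_limit_eq_SUP by (rule SUP_upper) simp
      finally show False using A(2) \<alpha> by simp
    qed
    then show ?thesis
      unfolding measure_pressure_scale_def pressure_on_scale_def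
      by (auto intro!: Inf_greatest)
  qed
  moreover have "0 < min \<eta> (\<epsilon>\<^sub>0 / 2)" using \<eta> \<epsilon>\<^sub>0 by simp
  ultimately show ?thesis
    unfolding eventually_at_right_field by blast
qed

lemma measure_pressure_eq_esssup:
  "measure_pressure \<mu> f \<phi> = esssup \<mu> (pointwise_pressure \<mu> f \<phi>)" (is "_ = ?E")
  unfolding measure_pressure_def
proof (intro tendsto_Lim tendsto_at_right_0_ereal_approx measure_pressure_scale_le_esssup)
  fix s assume "ereal s < ?E"
  \<comment> \<open>The preceding bound loses \<delta>, so it is applied to a larger
    \<open>t\<close> with \<open>\<delta> = t - s\<close>.\<close>
  then obtain t where t: "ereal s < ereal t" "ereal t < ?E" using ereal_dense2 by blast
  then show "\<forall>\<^sub>F \<epsilon> in at_right 0. ereal s \<le> measure_pressure_scale \<mu> f \<phi> \<epsilon>"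
    using eventually_le_measure_pressure_scale[OF t(2), of "t - s"] by simp
qed auto

end

theorem proposition4p1:
  fixes f :: "'a::metric_space \<Rightarrow> 'a" and \<phi> :: "'a \<Rightarrow> real" and \<mu> :: "'a measure"
  assumes "compact (UNIV :: 'a set)"
    and "continuous_on UNIV f"
    and "continuous_on UNIV \<phi>"
    and "\<mu> \<in> invariant_measures f"
  shows "measure_pressure \<mu> f \<phi> = esssup \<mu> (\<lambda>x. pointwise_pressure \<mu> f \<phi> x)"
proof -
  interpret prob_space \<mu> using assms(4) by (simp add: invariant_measures_def)
  interpret compact_borel_system \<mu> f \<phi>
    by unfold_locales (use assms in \<open>auto simp: invariant_measures_def\<close>)
  show ?thesis by (rule measure_pressure_eq_esssup)
qed

end
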